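(* Let $\mathbf{M}=\langle\mathbf{H},\square,\Diamond\rangle$ be a modal Heyting algebra. Then $\mathbf{N}(\mathbf{M})=\langle R(\mathbf{H}),\blacksquare,\Diamond_N\rangle$ is a modal Nelson lattice, where $R(\mathbf{H})=\{(x,y)\in H\times H: x\wedge y=\bot\}$ carries the twist operations $(x,y)\vee(s,t)=(x\vee s,y\wedge t)$, $(x,y)\wedge(s,t)=(x\wedge s,y\vee t)$, $(x,y)*(s,t)=(x\wedge s,(x\rightharpoonup t)\wedge(s\rightharpoonup y))$, $(x,y)\Rightarrow(s,t)=((x\rightharpoonup s)\wedge(t\rightharpoonup y),x\wedge t)$, $\top=(\top,\bot)$, $\bot=(\bot,\top)$, and the modal operators are $\blacksquare(x,y)=(\square x,\Diamond y)$ and $\Diamond_N(x,y)=(\Diamond x,\square y)$.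
   Context: A modal Heyting algebra is $\langle\mathbf{H},\square,\Diamond\rangle$ with $\mathbf{H}$ a Heyting algebra (implication $\rightharpoonup$, $-a=a\rightharpoonup\bot$) and unary $\square,\Diamond$ satisfying $\square a\wedge\Diamond(-a\wedge b)=\bot$. A Nelson lattice is an involutive residuated lattice $\langle A,\wedge,\vee,*,\Rightarrow,\top,\bot\rangle$ ($\sim a=a\Rightarrow\bot$, $\sim\sim a=a$, $a^2=a*a$) satisfying $((a^2\Rightarrow b)\wedge((\sim b)^2\Rightarrow\sim a))\Rightarrow(a\Rightarrow b)=\top$. A modal Nelson lattice is $\langle\mathbf{A},\blacksquare,\Diamond_N\rangle$ (here $\Diamond_N$ denotes the Nelson-level diamond, written as a black lozenge in the paper) with $\mathbf{A}$ a Nelson lattice such that for all $a,b$: $\Diamond_N a=\sim\blacksquare\sim a$; if $a^2=b^2$ then $(\blacksquare a)^2=(\blacksquare b)^2$ and $(\Diamond_N a)^2=(\Diamond_N b)^2$; and $(\blacksquare a\wedge\Diamond_N(\sim a^2\wedge b))^2=\bot$. *)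

theory Defs
  imports "HOL-Algebra.Group"
begin

(* HOL-Algebra derives these symbols from an order; here they denote the primitive operations
   of an algebra. *)
no_notation
  Order.gorder.le (infixl "\<sqsubseteq>\<index>" 50) and
  Order.top ("\<top>\<index>") and
  Order.bottom ("\<bottom>\<index>") and
  Lattice.join (infixl "\<squnion>\<index>" 65) and
  Lattice.meet (infixl "\<sqinter>\<index>" 70)

record 'a bl_struct = "'a partial_object" +
  lmeet :: "'a \<Rightarrow> 'a \<Rightarrow> 'a" (infixl "\<sqinter>\<index>" 70)
  ljoin :: "'a \<Rightarrow> 'a \<Rightarrow> 'a" (infixl "\<squnion>\<index>" 65)
  ltop :: 'a ("\<top>\<index>")
  lbot :: 'a ("\<bottom>\<index>")

definition lle :: "('a, 'm) bl_struct_scheme \<Rightarrow> 'a \<Rightarrow> 'a \<Rightarrow> bool" (infix "\<sqsubseteq>\<index>" 50)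
  where "x \<sqsubseteq>\<^bsub>L\<^esub> y \<longleftrightarrow> x \<sqinter>\<^bsub>L\<^esub> y = x"

locale bl_algebra =
  fixes L (structure)
  assumes meet_closed: "\<lbrakk>x \<in> carrier L; y \<in> carrier L\<rbrakk> \<Longrightarrow> x \<sqinter> y \<in> carrier L"
    and join_closed: "\<lbrakk>x \<in> carrier L; y \<in> carrier L\<rbrakk> \<Longrightarrow> x \<squnion> y \<in> carrier L"
    and top_closed: "\<top> \<in> carrier L"
    and bot_closed: "\<bottom> \<in> carrier L"
    and meet_assoc: "\<lbrakk>x \<in> carrier L; y \<in> carrier L; z \<in> carrier L\<rbrakk>
      \<Longrightarrow> (x \<sqinter> y) \<sqinter> z = x \<sqinter> (y \<sqinter> z)"
    and join_assoc: "\<lbrakk>x \<in> carrier L; y \<in> carrier L; z \<in> carrier L\<rbrakk>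
      \<Longrightarrow> (x \<squnion> y) \<squnion> z = x \<squnion> (y \<squnion> z)"
    and meet_comm: "\<lbrakk>x \<in> carrier L; y \<in> carrier L\<rbrakk> \<Longrightarrow> x \<sqinter> y = y \<sqinter> x"
    and join_comm: "\<lbrakk>x \<in> carrier L; y \<in> carrier L\<rbrakk> \<Longrightarrow> x \<squnion> y = y \<squnion> x"
    and meet_absorb: "\<lbrakk>x \<in> carrier L; y \<in> carrier L\<rbrakk> \<Longrightarrow> x \<sqinter> (x \<squnion> y) = x"
    and join_absorb: "\<lbrakk>x \<in> carrier L; y \<in> carrier L\<rbrakk> \<Longrightarrow> x \<squnion> (x \<sqinter> y) = x"
    and le_top: "x \<in> carrier L \<Longrightarrow> x \<sqsubseteq> \<top>"
    and bot_le: "x \<in> carrier L \<Longrightarrow> \<bottom> \<sqsubseteq> x"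

(* The induced order is a bounded lattice in the sense of HOL-Algebra, with the same operations. *)
definition bl_order :: "('a, 'm) bl_struct_scheme \<Rightarrow> 'a gorder"
  where "bl_order L = \<lparr>carrier = carrier L, eq = (=), le = lle L\<rparr>"

context bl_algebra
begin

lemma le_refl: "x \<in> carrier L \<Longrightarrow> x \<sqsubseteq> x"
  unfolding lle_def by (metis join_absorb meet_absorb meet_closed)

lemma le_antisym: "\<lbrakk>x \<in> carrier L; y \<in> carrier L; x \<sqsubseteq> y; y \<sqsubseteq> x\<rbrakk> \<Longrightarrow> x = y"
  unfolding lle_def by (metis meet_comm)

lemma le_trans:
  "\<lbrakk>x \<in> carrier L; y \<in> carrier L; z \<in> carrier L; x \<sqsubseteq> y; y \<sqsubseteq> z\<rbrakk> \<Longrightarrow> x \<sqsubseteq> z"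
  unfolding lle_def by (metis meet_assoc)

lemma le_meet_iff:
  "\<lbrakk>x \<in> carrier L; y \<in> carrier L; z \<in> carrier L\<rbrakk>
    \<Longrightarrow> z \<sqsubseteq> x \<sqinter> y \<longleftrightarrow> z \<sqsubseteq> x \<and> z \<sqsubseteq> y"
  by (smt (verit) le_refl lle_def meet_assoc meet_closed meet_comm)

lemma le_iff_join: "\<lbrakk>x \<in> carrier L; y \<in> carrier L\<rbrakk> \<Longrightarrow> x \<sqsubseteq> y \<longleftrightarrow> x \<squnion> y = y"
  unfolding lle_def by (metis join_absorb join_comm meet_absorb meet_comm)

lemma join_le_iff:
  "\<lbrakk>x \<in> carrier L; y \<in> carrier L; z \<in> carrier L\<rbrakk>
    \<Longrightarrow> x \<squnion> y \<sqsubseteq> z \<longleftrightarrow> x \<sqsubseteq> z \<and> y \<sqsubseteq> z"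
  by (smt (verit) join_assoc join_closed join_comm le_iff_join le_refl)

lemma greatest_meet:
  assumes "x \<in> carrier L" "y \<in> carrier L"
  shows "greatest (bl_order L) (x \<sqinter> y) (Lower (bl_order L) {x, y})"
  using assms le_meet_iff[of x y "x \<sqinter> y"] le_refl[of "x \<sqinter> y"] meet_closed[of x y]
  by (simp add: greatest_def Lower_def bl_order_def Ball_def le_meet_iff)

lemma least_join:
  assumes "x \<in> carrier L" "y \<in> carrier L"
  shows "least (bl_order L) (x \<squnion> y) (Upper (bl_order L) {x, y})"
  using assms join_le_iff[of x y "x \<squnion> y"] le_refl[of "x \<squnion> y"] join_closed[of x y]
  by (simp add: least_def Upper_def bl_order_def Ball_def join_le_iff)

lemma partial_order_bl_order: "partial_order (bl_order L)"
proof
  fix x y z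
  assume "x \<in> carrier (bl_order L)" "y \<in> carrier (bl_order L)" "z \<in> carrier (bl_order L)"
    and "gorder.le (bl_order L) x y" "gorder.le (bl_order L) y z"
  then show "gorder.le (bl_order L) x z"
    using le_trans[of x y z] by (simp add: bl_order_def)
qed (simp_all add: bl_order_def le_refl le_antisym)

lemma bounded_lattice_bl_order: "bounded_lattice (bl_order L)"
proof -
  interpret partial_order "bl_order L" by (rule partial_order_bl_order)
  show ?thesis
  proof
    fix x y assume "x \<in> carrier (bl_order L)" "y \<in> carrier (bl_order L)"
    then have xy: "x \<in> carrier L" "y \<in> carrier L" by (simp_all add: bl_order_def)
    show "\<exists>s. least (bl_order L) s (Upper (bl_order L) {x, y})"
      using least_join[OF xy] by blast
    show "\<exists>s. greatest (bl_order L) s (Lower (bl_order L) {x, y})"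
      using greatest_meet[OF xy] by blast
  next
    have "least (bl_order L) \<bottom> (carrier (bl_order L))"
      using bot_closed bot_le by (simp add: least_def bl_order_def)
    then show "\<exists>x. least (bl_order L) x (carrier (bl_order L))" by blast
    have "greatest (bl_order L) \<top> (carrier (bl_order L))"
      using top_closed le_top by (simp add: greatest_def bl_order_def)
    then show "\<exists>x. greatest (bl_order L) x (carrier (bl_order L))" by blast
  qed
qed

lemma meet_bl_order:
  assumes "x \<in> carrier L" "y \<in> carrier L"
  shows "Lattice.meet (bl_order L) x y = x \<sqinter> y"
proof -
  interpret partial_order "bl_order L" by (rule partial_order_bl_order)
  show ?thesis
    unfolding Lattice.meet_def Lattice.inf_def
    by (rule some_equality, rule greatest_meet[OF assms])
      (rule greatest_unique[OF _ greatest_meet[OF assms]])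
qed

lemma join_bl_order:
  assumes "x \<in> carrier L" "y \<in> carrier L"
  shows "Lattice.join (bl_order L) x y = x \<squnion> y"
proof -
  interpret partial_order "bl_order L" by (rule partial_order_bl_order)
  show ?thesis
    unfolding Lattice.join_def Lattice.sup_def
    by (rule some_equality, rule least_join[OF assms])
      (rule least_unique[OF _ least_join[OF assms]])
qed

end

record 'a heyting_struct = "'a bl_struct" +
  himp :: "'a \<Rightarrow> 'a \<Rightarrow> 'a" (infixr "\<rightharpoonup>\<index>" 60)

definition hneg :: "('a, 'm) heyting_struct_scheme \<Rightarrow> 'a \<Rightarrow> 'a"
  where "hneg H x = x \<rightharpoonup>\<^bsub>H\<^esub> \<bottom>\<^bsub>H\<^esub>"

locale heyting_algebra = bl_algebra H for H (structure) +
  assumes himp_closed: "\<lbrakk>x \<in> carrier H; y \<in> carrier H\<rbrakk> \<Longrightarrow> x \<rightharpoonup> y \<in> carrier H"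
    and himp_adjoint: "\<lbrakk>x \<in> carrier H; y \<in> carrier H; z \<in> carrier H\<rbrakk>
      \<Longrightarrow> x \<sqinter> y \<sqsubseteq> z \<longleftrightarrow> x \<sqsubseteq> y \<rightharpoonup> z"

record 'a modal_heyting_struct = "'a heyting_struct" +
  hbox :: "'a \<Rightarrow> 'a"
  hdia :: "'a \<Rightarrow> 'a"

locale modal_heyting_algebra = heyting_algebra M for M (structure) +
  assumes hbox_closed: "a \<in> carrier M \<Longrightarrow> hbox M a \<in> carrier M"
    and hdia_closed: "a \<in> carrier M \<Longrightarrow> hdia M a \<in> carrier M"
    and hbox_hdia: "\<lbrakk>a \<in> carrier M; b \<in> carrier M\<rbrakk>
      \<Longrightarrow> hbox M a \<sqinter> hdia M (hneg M a \<sqinter> b) = \<bottom>"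

record 'a residuated_struct = "'a bl_struct" +
  rmult :: "'a \<Rightarrow> 'a \<Rightarrow> 'a" (infixl "\<otimes>\<index>" 70)
  rimp :: "'a \<Rightarrow> 'a \<Rightarrow> 'a" (infixr "\<Rrightarrow>\<index>" 60)

no_notation Group.monoid.mult (infixl "\<otimes>\<index>" 70)

definition rneg :: "('a, 'm) residuated_struct_scheme \<Rightarrow> 'a \<Rightarrow> 'a"
  where "rneg A x = x \<Rrightarrow>\<^bsub>A\<^esub> \<bottom>\<^bsub>A\<^esub>"

definition rsquare :: "('a, 'm) residuated_struct_scheme \<Rightarrow> 'a \<Rightarrow> 'a"
  where "rsquare A x = x \<otimes>\<^bsub>A\<^esub> x"

(* Commutative, bounded and integral: the unit of the monoid is the top element. *)
locale residuated_lattice = bl_algebra A for A (structure) +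
  assumes mult_comm_monoid: "comm_monoid \<lparr>carrier = carrier A, mult = rmult A, one = \<top>\<rparr>"
    and rimp_closed: "\<lbrakk>x \<in> carrier A; y \<in> carrier A\<rbrakk> \<Longrightarrow> x \<Rrightarrow> y \<in> carrier A"
    and rimp_adjoint: "\<lbrakk>x \<in> carrier A; y \<in> carrier A; z \<in> carrier A\<rbrakk>
      \<Longrightarrow> x \<otimes> y \<sqsubseteq> z \<longleftrightarrow> x \<sqsubseteq> y \<Rrightarrow> z"

locale involutive_residuated_lattice = residuated_lattice A for A (structure) +
  assumes rneg_rneg: "x \<in> carrier A \<Longrightarrow> rneg A (rneg A x) = x"

locale nelson_lattice = involutive_residuated_lattice A for A (structure) +
  assumes nelson: "\<lbrakk>a \<in> carrier A; b \<in> carrier A\<rbrakk> \<Longrightarrow>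
    ((rsquare A a \<Rrightarrow> b) \<sqinter> (rsquare A (rneg A b) \<Rrightarrow> rneg A a)) \<Rrightarrow> (a \<Rrightarrow> b) = \<top>"

record 'a modal_nelson_struct = "'a residuated_struct" +
  nbox :: "'a \<Rightarrow> 'a"
  ndia :: "'a \<Rightarrow> 'a"

locale modal_nelson_lattice = nelson_lattice A for A (structure) +
  assumes nbox_closed: "a \<in> carrier A \<Longrightarrow> nbox A a \<in> carrier A"
    and ndia_closed: "a \<in> carrier A \<Longrightarrow> ndia A a \<in> carrier A"
    and ndia_dual: "a \<in> carrier A \<Longrightarrow> ndia A a = rneg A (nbox A (rneg A a))"
    and nbox_square_cong: "\<lbrakk>a \<in> carrier A; b \<in> carrier A; rsquare A a = rsquare A b\<rbrakk>
      \<Longrightarrow> rsquare A (nbox A a) = rsquare A (nbox A b)"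
    and ndia_square_cong: "\<lbrakk>a \<in> carrier A; b \<in> carrier A; rsquare A a = rsquare A b\<rbrakk>
      \<Longrightarrow> rsquare A (ndia A a) = rsquare A (ndia A b)"
    (* The negation applies to the square of a. *)
    and nbox_ndia: "\<lbrakk>a \<in> carrier A; b \<in> carrier A\<rbrakk>
      \<Longrightarrow> rsquare A (nbox A a \<sqinter> ndia A (rneg A (rsquare A a) \<sqinter> b)) = \<bottom>"

definition twist_carrier :: "('a, 'm) heyting_struct_scheme \<Rightarrow> ('a \<times> 'a) set"
  where "twist_carrier H =
    {(x, y). x \<in> carrier H \<and> y \<in> carrier H \<and> x \<sqinter>\<^bsub>H\<^esub> y = \<bottom>\<^bsub>H\<^esub>}"

definition modal_twist ::
    "('a, 'm) modal_heyting_struct_scheme \<Rightarrow> ('a \<times> 'a) modal_nelson_struct"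
  where "modal_twist M = \<lparr>
    carrier = twist_carrier M,
    lmeet = (\<lambda>(x, y) (s, t). (x \<sqinter>\<^bsub>M\<^esub> s, y \<squnion>\<^bsub>M\<^esub> t)),
    ljoin = (\<lambda>(x, y) (s, t). (x \<squnion>\<^bsub>M\<^esub> s, y \<sqinter>\<^bsub>M\<^esub> t)),
    ltop = (\<top>\<^bsub>M\<^esub>, \<bottom>\<^bsub>M\<^esub>),
    lbot = (\<bottom>\<^bsub>M\<^esub>, \<top>\<^bsub>M\<^esub>),
    rmult = (\<lambda>(x, y) (s, t). (x \<sqinter>\<^bsub>M\<^esub> s, (x \<rightharpoonup>\<^bsub>M\<^esub> t) \<sqinter>\<^bsub>M\<^esub> (s \<rightharpoonup>\<^bsub>M\<^esub> y))),
    rimp = (\<lambda>(x, y) (s, t). ((x \<rightharpoonup>\<^bsub>M\<^esub> s) \<sqinter>\<^bsub>M\<^esub> (t \<rightharpoonup>\<^bsub>M\<^esub> y), x \<sqinter>\<^bsub>M\<^esub> t)),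
    nbox = (\<lambda>(x, y). (hbox M x, hdia M y)),
    ndia = (\<lambda>(x, y). (hdia M x, hbox M y))\<rparr>"

end

(* In R(H) the negation swaps the components and (x, y)^2 = (x, -x), so the square of a pair retains
   exactly its first component; this makes every axiom involving squares a statement about first
   components.  The lattice and residuation laws are checked in H by the Yoneda principle: by
   adjunction, z \<sqsubseteq> x \<rightharpoonup> t says that the meet of z and x lies below t, and in this form the expressions
   become symmetric in the factors. *)
theory Submission
  imports Defs
begin

section \<open>Order calculus of bounded lattices\<close>

context bl_algebra
begin

lemma meet_left_comm:
  "\<lbrakk>x \<in> carrier L; y \<in> carrier L; z \<in> carrier L\<rbrakk> \<Longrightarrow> x \<sqinter> (y \<sqinter> z) = y \<sqinter> (x \<sqinter> z)"
  by (metis meet_assoc meet_comm)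

text \<open>The form of antisymmetry suited to implications, which the adjunction describes only
  through their lower bounds.\<close>

lemma eq_by_lower_bounds:
  assumes "x \<in> carrier L" "y \<in> carrier L"
    and "\<And>z. z \<in> carrier L \<Longrightarrow> z \<sqsubseteq> x \<longleftrightarrow> z \<sqsubseteq> y"
  shows "x = y"
  using assms by (meson le_antisym le_refl)

lemma le_bot_iff: "x \<in> carrier L \<Longrightarrow> x \<sqsubseteq> \<bottom> \<longleftrightarrow> x = \<bottom>"
  by (meson bot_closed bot_le le_antisym le_refl)

lemma top_le_iff: "x \<in> carrier L \<Longrightarrow> \<top> \<sqsubseteq> x \<longleftrightarrow> x = \<top>"
  by (meson top_closed le_top le_antisym le_refl)

lemma top_meet: "x \<in> carrier L \<Longrightarrow> \<top> \<sqinter> x = x"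
  by (metis le_top lle_def meet_comm top_closed)

lemma bot_meet: "x \<in> carrier L \<Longrightarrow> \<bottom> \<sqinter> x = \<bottom>"
  by (metis bot_le lle_def)

lemma meet_top: "x \<in> carrier L \<Longrightarrow> x \<sqinter> \<top> = x"
  by (metis le_top lle_def)

lemma meet_bot: "x \<in> carrier L \<Longrightarrow> x \<sqinter> \<bottom> = \<bottom>"
  by (metis bot_meet meet_comm bot_closed)

lemma meet_idem: "x \<in> carrier L \<Longrightarrow> x \<sqinter> x = x"
  by (metis le_refl lle_def)

lemma join_idem: "x \<in> carrier L \<Longrightarrow> x \<squnion> x = x"
  by (metis le_refl le_iff_join)

lemma meet_le_left: "\<lbrakk>x \<in> carrier L; y \<in> carrier L\<rbrakk> \<Longrightarrow> x \<sqinter> y \<sqsubseteq> x"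
  by (metis le_meet_iff le_refl meet_closed)

lemma meet_le_right: "\<lbrakk>x \<in> carrier L; y \<in> carrier L\<rbrakk> \<Longrightarrow> x \<sqinter> y \<sqsubseteq> y"
  by (metis le_meet_iff le_refl meet_closed)

end

section \<open>Implication and pseudocomplement in a Heyting algebra\<close>

context heyting_algebra
begin

lemma le_himp_iff:
  "\<lbrakk>x \<in> carrier H; y \<in> carrier H; z \<in> carrier H\<rbrakk> \<Longrightarrow> x \<sqsubseteq> y \<rightharpoonup> z \<longleftrightarrow> x \<sqinter> y \<sqsubseteq> z"
  by (simp add: himp_adjoint)

lemma hneg_closed: "x \<in> carrier H \<Longrightarrow> hneg H x \<in> carrier H"
  by (simp add: hneg_def himp_closed bot_closed)

lemma le_hneg_iff:
  "\<lbrakk>x \<in> carrier H; y \<in> carrier H\<rbrakk> \<Longrightarrow> x \<sqsubseteq> hneg H y \<longleftrightarrow> y \<sqinter> x = \<bottom>"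
  by (simp add: hneg_def le_himp_iff bot_closed le_bot_iff meet_closed meet_comm)

text \<open>Whatever \<open>z \<sqinter> x\<close> lies below, it lies below \<open>x\<close> as
  well; so being below \<open>y\<close> forces it below \<open>x \<sqinter> y = \<bottom>\<close>.
  This is why \<open>y\<close> disappears from the square of \<open>(x, y)\<close>.\<close>

lemma himp_disjoint:
  assumes xy: "x \<in> carrier H" "y \<in> carrier H" "x \<sqinter> y = \<bottom>"
  shows "x \<rightharpoonup> y = hneg H x"
proof (rule eq_by_lower_bounds)
  fix z assume z: "z \<in> carrier H"
  have "z \<sqinter> x \<sqsubseteq> y \<longleftrightarrow> z \<sqinter> x \<sqsubseteq> x \<sqinter> y"
    using xy(1,2) z by (simp add: le_meet_iff meet_closed meet_le_right)
  then show "z \<sqsubseteq> x \<rightharpoonup> y \<longleftrightarrow> z \<sqsubseteq> hneg H x"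
    using xy z by (simp add: le_himp_iff hneg_def bot_closed)
qed (use xy in \<open>simp_all add: himp_closed hneg_closed\<close>)

text \<open>Disjointness places \<open>y\<close> below the pseudocomplement of \<open>x\<close>.
  This recovers \<open>y\<close> in the twist negation, in the unit law and in the modal
  axiom.\<close>

lemma hneg_meet_disjoint:
  "\<lbrakk>x \<in> carrier H; y \<in> carrier H; x \<sqinter> y = \<bottom>\<rbrakk> \<Longrightarrow> hneg H x \<sqinter> y = y"
  by (metis hneg_closed le_hneg_iff lle_def meet_comm)

lemma meet_hneg: "x \<in> carrier H \<Longrightarrow> x \<sqinter> hneg H x = \<bottom>"
  using hneg_closed le_hneg_iff le_refl by blast

lemma top_himp: "x \<in> carrier H \<Longrightarrow> \<top> \<rightharpoonup> x = x"
  by (rule eq_by_lower_bounds) (simp_all add: le_himp_iff meet_top top_closed himp_closed)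

lemma hneg_bot: "hneg H \<bottom> = \<top>"
  using top_le_iff[of "hneg H \<bottom>"]
  by (simp add: hneg_closed le_hneg_iff bot_closed top_closed bot_meet)

text \<open>Modus ponens, the counit of the adjunction.\<close>

lemma meet_himp_le:
  assumes "x \<in> carrier H" "y \<in> carrier H"
  shows "x \<sqinter> (x \<rightharpoonup> y) \<sqsubseteq> y"
  using assms le_himp_iff[of "x \<rightharpoonup> y" x y] by (simp add: himp_closed le_refl meet_comm)

text \<open>After regrouping, modus ponens puts \<open>x \<sqinter> (x \<rightharpoonup> t)\<close>
  below \<open>t\<close>, while the other block lies below \<open>s\<close>; the whole is then below
  \<open>s \<sqinter> t = \<bottom>\<close>.\<close>

lemma twist_mult_closed:
  assumes c: "x \<in> carrier H" "y \<in> carrier H" "s \<in> carrier H" "t \<in> carrier H"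
    and d: "s \<sqinter> t = \<bottom>"
  shows "(x \<sqinter> s) \<sqinter> ((x \<rightharpoonup> t) \<sqinter> (s \<rightharpoonup> y)) = \<bottom>"
proof -
  let ?w = "(x \<sqinter> s) \<sqinter> ((x \<rightharpoonup> t) \<sqinter> (s \<rightharpoonup> y))"
  have eq: "?w = (x \<sqinter> (x \<rightharpoonup> t)) \<sqinter> (s \<sqinter> (s \<rightharpoonup> y))"
    using c by (simp add: meet_assoc meet_left_comm meet_closed himp_closed)
  have m: "?w \<in> carrier H" using c by (simp add: meet_closed himp_closed)
  have "?w \<sqsubseteq> x \<sqinter> (x \<rightharpoonup> t)"
    unfolding eq using c by (simp add: meet_le_left meet_closed himp_closed)
  then have "?w \<sqsubseteq> t"
    using c m le_trans[OF m _ _ _ meet_himp_le] by (simp add: meet_closed himp_closed)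
  moreover have "?w \<sqsubseteq> s \<sqinter> (s \<rightharpoonup> y)"
    unfolding eq using c by (simp add: meet_le_right meet_closed himp_closed)
  then have "?w \<sqsubseteq> s"
    using c m by (simp add: le_meet_iff himp_closed)
  ultimately show ?thesis
    using c m d le_meet_iff[of s t ?w] by (simp add: le_bot_iff)
qed

end

section \<open>The twist operations computed on explicit pairs\<close>

lemma modal_twist_sel [simp]:
  "carrier (modal_twist M) = twist_carrier M"
  "\<top>\<^bsub>modal_twist M\<^esub> = (\<top>\<^bsub>M\<^esub>, \<bottom>\<^bsub>M\<^esub>)"
  "\<bottom>\<^bsub>modal_twist M\<^esub> = (\<bottom>\<^bsub>M\<^esub>, \<top>\<^bsub>M\<^esub>)"
  "(x, y) \<sqinter>\<^bsub>modal_twist M\<^esub> (s, t) = (x \<sqinter>\<^bsub>M\<^esub> s, y \<squnion>\<^bsub>M\<^esub> t)"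
  "(x, y) \<squnion>\<^bsub>modal_twist M\<^esub> (s, t) = (x \<squnion>\<^bsub>M\<^esub> s, y \<sqinter>\<^bsub>M\<^esub> t)"
  "(x, y) \<otimes>\<^bsub>modal_twist M\<^esub> (s, t) =
    (x \<sqinter>\<^bsub>M\<^esub> s, (x \<rightharpoonup>\<^bsub>M\<^esub> t) \<sqinter>\<^bsub>M\<^esub> (s \<rightharpoonup>\<^bsub>M\<^esub> y))"
  "(x, y) \<Rrightarrow>\<^bsub>modal_twist M\<^esub> (s, t) =
    ((x \<rightharpoonup>\<^bsub>M\<^esub> s) \<sqinter>\<^bsub>M\<^esub> (t \<rightharpoonup>\<^bsub>M\<^esub> y), x \<sqinter>\<^bsub>M\<^esub> t)"
  "nbox (modal_twist M) (x, y) = (hbox M x, hdia M y)"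
  "ndia (modal_twist M) (x, y) = (hdia M x, hbox M y)"
  by (simp_all add: modal_twist_def)

lemma mem_twist_carrier [simp]:
  "(x, y) \<in> twist_carrier H \<longleftrightarrow>
    x \<in> carrier H \<and> y \<in> carrier H \<and> x \<sqinter>\<^bsub>H\<^esub> y = \<bottom>\<^bsub>H\<^esub>"
  by (simp add: twist_carrier_def)

section \<open>The twist structure as a residuated lattice\<close>

context modal_heyting_algebra
begin

lemmas closed = meet_closed join_closed top_closed bot_closed himp_closed hneg_closed
  hbox_closed hdia_closed

text \<open>Since \<open>y = hneg M x \<sqinter> y\<close> for disjoint \<open>x\<close> and
  \<open>y\<close>, this is an instance of the modal Heyting axiom. It keeps both Nelson modalities
  inside the twist carrier.\<close>

lemma box_meet_dia_disjoint:
  "\<lbrakk>x \<in> carrier M; y \<in> carrier M; x \<sqinter> y = \<bottom>\<rbrakk> \<Longrightarrow> hbox M x \<sqinter> hdia M y = \<bottom>"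
  by (metis hbox_hdia hneg_meet_disjoint)

text \<open>The element \<open>y \<sqinter> t\<close> is disjoint from \<open>x\<close> and from
  \<open>s\<close>, so its pseudocomplement bounds both and hence their join. The argument through
  the pseudocomplement replaces an appeal to distributivity.\<close>

lemma join_meet_disjoint:
  assumes c: "x \<in> carrier M" "y \<in> carrier M" "s \<in> carrier M" "t \<in> carrier M"
    and d: "x \<sqinter> y = \<bottom>" "s \<sqinter> t = \<bottom>"
  shows "(x \<squnion> s) \<sqinter> (y \<sqinter> t) = \<bottom>"
proof -
  have "(y \<sqinter> t) \<sqinter> x = \<bottom>" "(y \<sqinter> t) \<sqinter> s = \<bottom>"
    using c d by (metis bot_meet meet_assoc meet_comm)+
  then have "x \<sqsubseteq> hneg M (y \<sqinter> t)" "s \<sqsubseteq> hneg M (y \<sqinter> t)"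
    using c by (simp_all add: le_hneg_iff closed)
  then have "x \<squnion> s \<sqsubseteq> hneg M (y \<sqinter> t)"
    using c by (simp add: join_le_iff closed)
  then have "(y \<sqinter> t) \<sqinter> (x \<squnion> s) = \<bottom>"
    using c by (simp add: le_hneg_iff closed)
  then show ?thesis
    using c meet_comm[of "x \<squnion> s" "y \<sqinter> t"] by (simp add: closed)
qed

text \<open>The second component is ordered in reverse because the twist meet joins it;
  \<open>le_iff_join\<close> reads the resulting join equation as an inequality.\<close>

lemma twist_le:
  assumes "x \<in> carrier M" "y \<in> carrier M" "s \<in> carrier M" "t \<in> carrier M"
  shows "(x, y) \<sqsubseteq>\<^bsub>modal_twist M\<^esub> (s, t) \<longleftrightarrow> x \<sqsubseteq> s \<and> t \<sqsubseteq> y"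
  using assms by (auto simp: lle_def[of "modal_twist M"] lle_def[of M x] le_iff_join join_comm)

lemma bl_algebra_modal_twist: "bl_algebra (modal_twist M)"
proof
  fix p q assume "p \<in> carrier (modal_twist M)" "q \<in> carrier (modal_twist M)"
  then show "p \<sqinter>\<^bsub>modal_twist M\<^esub> q \<in> carrier (modal_twist M)"
    \<comment> \<open>Exchanging the components of both pairs turns closure under meet into closure
      under join.\<close>
    by (cases p; cases q) (simp add: closed, metis join_meet_disjoint meet_comm closed(1,2))
next
  fix p q assume "p \<in> carrier (modal_twist M)" "q \<in> carrier (modal_twist M)"
  then show "p \<squnion>\<^bsub>modal_twist M\<^esub> q \<in> carrier (modal_twist M)"
    by (cases p; cases q) (simp add: closed join_meet_disjoint)
next
  fix p q assume "p \<in> carrier (modal_twist M)" "q \<in> carrier (modal_twist M)"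
  then show "p \<sqinter>\<^bsub>modal_twist M\<^esub> q = q \<sqinter>\<^bsub>modal_twist M\<^esub> p"
    "p \<squnion>\<^bsub>modal_twist M\<^esub> q = q \<squnion>\<^bsub>modal_twist M\<^esub> p"
    by (cases p; cases q; simp add: meet_comm join_comm)+
qed (auto simp: closed meet_top meet_bot bot_meet meet_assoc join_assoc meet_absorb join_absorb
    twist_le le_top bot_le)

lemma twist_rneg:
  "(x, y) \<in> twist_carrier M \<Longrightarrow> rneg (modal_twist M) (x, y) = (y, x)"
  by (simp add: rneg_def top_himp meet_top hneg_def[symmetric] hneg_meet_disjoint)

text \<open>By \<open>himp_disjoint\<close> both conjuncts \<open>x \<rightharpoonup> y\<close> of
  the second component equal \<open>hneg M x\<close>.\<close>

lemma twist_rsquare: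
  "(x, y) \<in> twist_carrier M \<Longrightarrow> rsquare (modal_twist M) (x, y) = (x, hneg M x)"
  by (simp add: rsquare_def himp_disjoint meet_idem closed)

lemma twist_rimp_closed:
  assumes "p \<in> twist_carrier M" "q \<in> twist_carrier M"
  shows "p \<Rrightarrow>\<^bsub>modal_twist M\<^esub> q \<in> twist_carrier M"
proof -
  obtain x y s t where [simp]: "p = (x, y)" "q = (s, t)" by fastforce
  \<comment> \<open>The implication from \<open>p\<close> to \<open>q\<close> is the product of
    \<open>p\<close> with \<open>(t, s)\<close>, the negation of \<open>q\<close>, with its
    components exchanged; closure of the product therefore applies.\<close>
  have "(x \<sqinter> t) \<sqinter> ((x \<rightharpoonup> s) \<sqinter> (t \<rightharpoonup> y)) = \<bottom>"
    using assms by (intro twist_mult_closed) (simp_all add: meet_comm)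
  then show ?thesis using assms by (simp add: closed meet_comm)
qed

lemma twist_mult_assoc:
  assumes "p \<in> twist_carrier M" "q \<in> twist_carrier M" "r \<in> twist_carrier M"
  shows "(p \<otimes>\<^bsub>modal_twist M\<^esub> q) \<otimes>\<^bsub>modal_twist M\<^esub> r =
    p \<otimes>\<^bsub>modal_twist M\<^esub> (q \<otimes>\<^bsub>modal_twist M\<^esub> r)"
proof -
  obtain x y s t u v where [simp]: "p = (x, y)" "q = (s, t)" "r = (u, v)" by (metis prod.exhaust)
  have c: "x \<in> carrier M" "y \<in> carrier M" "s \<in> carrier M" "t \<in> carrier M"
    "u \<in> carrier M" "v \<in> carrier M" using assms by simp_all
  \<comment> \<open>An element \<open>z\<close> is below either side exactly when
    \<open>z \<sqinter> x \<sqinter> s \<sqsubseteq> v\<close>,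
    \<open>z \<sqinter> x \<sqinter> u \<sqsubseteq> t\<close> and
    \<open>z \<sqinter> s \<sqinter> u \<sqsubseteq> y\<close>.\<close>
  have "((x \<sqinter> s) \<rightharpoonup> v) \<sqinter> (u \<rightharpoonup> ((x \<rightharpoonup> t) \<sqinter> (s \<rightharpoonup> y))) =
    (x \<rightharpoonup> ((s \<rightharpoonup> v) \<sqinter> (u \<rightharpoonup> t))) \<sqinter> ((s \<sqinter> u) \<rightharpoonup> y)"
    using c by (intro eq_by_lower_bounds)
      (auto simp: closed le_meet_iff le_himp_iff meet_assoc meet_comm meet_left_comm)
  then show ?thesis using c by (simp add: meet_assoc)
qed

lemma twist_comm_monoid:
  "comm_monoid \<lparr>carrier = twist_carrier M, mult = rmult (modal_twist M), one = (\<top>, \<bottom>)\<rparr>"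
proof (rule comm_monoidI; simp)
  fix p q assume "p \<in> twist_carrier M" "q \<in> twist_carrier M"
  then show "p \<otimes>\<^bsub>modal_twist M\<^esub> q \<in> twist_carrier M"
    by (cases p; cases q) (simp add: closed twist_mult_closed)
  show "p \<otimes>\<^bsub>modal_twist M\<^esub> q = q \<otimes>\<^bsub>modal_twist M\<^esub> p"
    using \<open>p \<in> _\<close> \<open>q \<in> _\<close> by (cases p; cases q) (simp add: closed meet_comm)
next
  fix p assume "p \<in> twist_carrier M"
  then show "(\<top>, \<bottom>) \<otimes>\<^bsub>modal_twist M\<^esub> p = p"
  proof (cases p)
    case (Pair x y)
    \<comment> \<open>Multiplying by the unit yields the second component \<open>(\<top>
      \<rightharpoonup> y) \<sqinter> (x \<rightharpoonup> \<bottom>)\<close>, that is,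
      \<open>y \<sqinter> hneg M x\<close>.\<close>
    then have "y \<sqinter> hneg M x = y"
      using \<open>p \<in> _\<close> hneg_meet_disjoint[of x y] by (simp add: meet_comm hneg_closed)
    with Pair \<open>p \<in> _\<close> show ?thesis
      by (simp add: closed top_meet top_himp flip: hneg_def)
  qed
qed (simp_all add: twist_mult_assoc closed meet_bot)

text \<open>Both sides unfold to the same three inequalities:
  \<open>x \<sqinter> s \<sqsubseteq> u\<close>, \<open>x \<sqinter> v \<sqsubseteq> t\<close> and
  \<open>s \<sqinter> v \<sqsubseteq> y\<close>.\<close>

lemma twist_adjoint:
  assumes "p \<in> twist_carrier M" "q \<in> twist_carrier M" "r \<in> twist_carrier M"
  shows "p \<otimes>\<^bsub>modal_twist M\<^esub> q \<sqsubseteq>\<^bsub>modal_twist M\<^esub> r \<longleftrightarrow>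
    p \<sqsubseteq>\<^bsub>modal_twist M\<^esub> q \<Rrightarrow>\<^bsub>modal_twist M\<^esub> r"
proof -
  obtain x y s t u v where [simp]: "p = (x, y)" "q = (s, t)" "r = (u, v)" by (metis prod.exhaust)
  show ?thesis
    using assms by (auto simp: twist_le closed le_meet_iff le_himp_iff meet_comm)
qed

lemma twist_residuated_lattice: "residuated_lattice (modal_twist M)"
  by (intro residuated_lattice.intro residuated_lattice_axioms.intro bl_algebra_modal_twist)
    (simp_all add: twist_comm_monoid twist_rimp_closed twist_adjoint)

end

text \<open>The top is the monoid unit, so residuation turns
  \<open>\<top> \<otimes> x \<sqsubseteq> y\<close> into
  \<open>\<top> \<sqsubseteq> x \<Rrightarrow> y\<close>. This reduces the Nelson identity to an
  inequality.\<close>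

lemma (in residuated_lattice) rimp_eq_top:
  assumes "x \<in> carrier A" "y \<in> carrier A" "x \<sqsubseteq> y"
  shows "x \<Rrightarrow> y = \<top>"
proof -
  interpret mult: comm_monoid "\<lparr>carrier = carrier A, mult = rmult A, one = \<top>\<rparr>"
    by (rule mult_comm_monoid)
  have "\<top> \<otimes> x = x" using mult.l_one[of x] assms(1) by simp
  then show ?thesis
    using assms rimp_adjoint[of \<top> x y] by (simp add: top_closed top_le_iff rimp_closed)
qed

section \<open>The Nelson identity in the twist structure\<close>

context modal_heyting_algebra
begin

lemma twist_nelson:
  assumes p: "p \<in> twist_carrier M" and q: "q \<in> twist_carrier M"
  defines "A \<equiv> modal_twist M"
  shows "((rsquare A p \<Rrightarrow>\<^bsub>A\<^esub> q) \<sqinter>\<^bsub>A\<^esub>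
    (rsquare A (rneg A q) \<Rrightarrow>\<^bsub>A\<^esub> rneg A p)) \<Rrightarrow>\<^bsub>A\<^esub> (p \<Rrightarrow>\<^bsub>A\<^esub> q) = \<top>\<^bsub>A\<^esub>"
proof -
  interpret A: residuated_lattice A unfolding A_def by (rule twist_residuated_lattice)
  obtain x y s t where pq: "p = (x, y)" "q = (s, t)" by fastforce
  have c: "x \<in> carrier M" "y \<in> carrier M" "s \<in> carrier M" "t \<in> carrier M"
    and d: "x \<sqinter> y = \<bottom>" "s \<sqinter> t = \<bottom>" "t \<sqinter> s = \<bottom>" "y \<sqinter> x = \<bottom>"
    using p q by (simp_all add: pq meet_comm)
  let ?l = "(rsquare A p \<Rrightarrow>\<^bsub>A\<^esub> q) \<sqinter>\<^bsub>A\<^esub> (rsquare A (rneg A q) \<Rrightarrow>\<^bsub>A\<^esub> rneg A p)"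
  have sq: "rsquare A p = (x, hneg M x)" "rneg A p = (y, x)" "rneg A q = (t, s)"
    "rsquare A (t, s) = (t, hneg M t)"
    using c d by (simp_all add: A_def pq twist_rsquare twist_rneg)
  have "?l \<in> carrier A"
    unfolding sq by (intro A.meet_closed A.rimp_closed)
      (use c d in \<open>simp_all add: A_def pq closed meet_hneg\<close>)
  moreover have "p \<Rrightarrow>\<^bsub>A\<^esub> q \<in> carrier A"
    using p q by (simp add: A_def twist_rimp_closed)
  moreover have "?l \<sqsubseteq>\<^bsub>A\<^esub> p \<Rrightarrow>\<^bsub>A\<^esub> q"
  proof -
    \<comment> \<open>\<open>?a\<close> and \<open>?b\<close> are the first components of the two
      implications in \<open>?l\<close>. Their second components are both
      \<open>x \<sqinter> t\<close>, as is that of the implication from \<open>p\<close> to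
      \<open>q\<close>, so only first components remain to be compared.\<close>
    let ?a = "(x \<rightharpoonup> s) \<sqinter> (t \<rightharpoonup> hneg M x)" and ?b = "(t \<rightharpoonup> y) \<sqinter> (x \<rightharpoonup> hneg M t)"
    have "?a \<sqinter> ?b \<sqsubseteq> x \<rightharpoonup> s" "?a \<sqinter> ?b \<sqsubseteq> t \<rightharpoonup> y"
      using c le_refl[of "?a \<sqinter> ?b"] by (simp_all only: le_meet_iff closed)
    then show ?thesis
      unfolding sq using c
      by (simp add: A_def pq twist_le closed le_meet_iff meet_comm[of t x] join_idem le_refl)
  qed
  ultimately show ?thesis by (rule A.rimp_eq_top)
qed

lemma nelson_lattice_modal_twist: "nelson_lattice (modal_twist M)"
  by (intro nelson_lattice.intro nelson_lattice_axioms.intro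
      involutive_residuated_lattice.intro involutive_residuated_lattice_axioms.intro
      twist_residuated_lattice)
    (auto simp: twist_nelson twist_rneg meet_comm)

section \<open>The modal axioms in the twist structure\<close>

lemma modal_nelson_lattice_modal_twist: "modal_nelson_lattice (modal_twist M)"
proof (intro modal_nelson_lattice.intro nelson_lattice_modal_twist
    modal_nelson_lattice_axioms.intro)
  let ?A = "modal_twist M"
  fix p assume p: "p \<in> carrier ?A"
  obtain x y where xy [simp]: "p = (x, y)" by fastforce
  have c: "x \<in> carrier M" "y \<in> carrier M" "x \<sqinter> y = \<bottom>" "y \<sqinter> x = \<bottom>"
    using p by (simp_all add: meet_comm)
  have dia_box: "hdia M x \<sqinter> hbox M y = \<bottom>"
    using c box_meet_dia_disjoint[of y x] by (simp add: meet_comm closed)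
  show box: "nbox ?A p \<in> carrier ?A" and dia: "ndia ?A p \<in> carrier ?A"
    using c dia_box by (simp_all add: closed box_meet_dia_disjoint)
  \<comment> \<open>Negation exchanges components, so conjugating the box
    \<open>(hbox M x, hdia M y)\<close> by it exchanges the roles of the two Heyting
    modalities.\<close>
  show "ndia ?A p = rneg ?A (nbox ?A (rneg ?A p))"
    using c by (simp add: twist_rneg closed box_meet_dia_disjoint)
  fix q assume q: "q \<in> carrier ?A"
  obtain s t where st [simp]: "q = (s, t)" by fastforce
  have c': "s \<in> carrier M" "t \<in> carrier M" "s \<sqinter> t = \<bottom>" "t \<sqinter> s = \<bottom>"
    using q by (simp_all add: meet_comm)
  have dia_box': "hdia M s \<sqinter> hbox M t = \<bottom>"
    using c' box_meet_dia_disjoint[of t s] by (simp add: meet_comm closed)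
  \<comment> \<open>Equal squares force \<open>x = s\<close>, and the squares of the modal images
    depend only on \<open>hbox M x\<close> or \<open>hdia M x\<close>.\<close>
  show "rsquare ?A (nbox ?A p) = rsquare ?A (nbox ?A q)"
    "rsquare ?A (ndia ?A p) = rsquare ?A (ndia ?A q)"
    if "rsquare ?A p = rsquare ?A q"
    using that c c' dia_box dia_box'
    by (simp_all add: twist_rsquare closed box_meet_dia_disjoint)
  interpret A: bl_algebra ?A by (rule bl_algebra_modal_twist)
  let ?r = "rneg ?A (rsquare ?A p) \<sqinter>\<^bsub>?A\<^esub> q"
  \<comment> \<open>The square of \<open>p\<close> is \<open>(x, hneg M x)\<close>, whose negation
    is \<open>(hneg M x, x)\<close>.\<close>
  have r: "?r = (hneg M x \<sqinter> s, x \<squnion> t)"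
    using c by (simp add: twist_rsquare twist_rneg closed meet_hneg)
  have "(hneg M x, x) \<in> carrier ?A" using c by (simp add: closed meet_hneg meet_comm)
  then have "(hneg M x, x) \<sqinter>\<^bsub>?A\<^esub> q \<in> carrier ?A" using q by (rule A.meet_closed)
  \<comment> \<open>Disjointness is read off from membership of the twist meet in the
    carrier.\<close>
  then have disj: "(hneg M x \<sqinter> s) \<sqinter> (x \<squnion> t) = \<bottom>" by simp
  have "(x \<squnion> t) \<sqinter> (hneg M x \<sqinter> s) = \<bottom>"
    using disj c c' by (simp add: meet_comm closed)
  then have "hbox M (x \<squnion> t) \<sqinter> hdia M (hneg M x \<sqinter> s) = \<bottom>"
    using c c' by (simp add: box_meet_dia_disjoint closed)
  then have "ndia ?A ?r \<in> carrier ?A"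
    unfolding r using c c' by (simp add: closed meet_comm)
  then have "nbox ?A p \<sqinter>\<^bsub>?A\<^esub> ndia ?A ?r \<in> carrier ?A"
    using box by (intro A.meet_closed)
  \<comment> \<open>The first component is
    \<open>hbox M x \<sqinter> hdia M (hneg M x \<sqinter> s)\<close>, which the modal Heyting axiom
    makes \<open>\<bottom>\<close>; the square is then
    \<open>(\<bottom>, hneg M \<bottom>) = (\<bottom>, \<top>)\<close>.\<close>
  then show "rsquare ?A (nbox ?A p \<sqinter>\<^bsub>?A\<^esub> ndia ?A ?r) = \<bottom>\<^bsub>?A\<^esub>"
    unfolding r using c c' by (simp add: twist_rsquare hbox_hdia hneg_bot)
qed

end

theorem theorem3:
  fixes M :: "('a, 'm) modal_heyting_struct_scheme"
  assumes "modal_heyting_algebra M"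
  shows "modal_nelson_lattice (modal_twist M)"
  using assms by (rule modal_heyting_algebra.modal_nelson_lattice_modal_twist)

end
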